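(* Let $h$ be a real nonnegative function on $\mathcal{X}$, bounded by $1$. Let $\mathcal{C}$ be a symmetric set (i.e. $\mathcal{C}=-\mathcal{C}$) included in the kernel of $M_h^*\circ\Pi^*$, and let $\mu_0$ be a probability measure on $\Theta$. Then for any number $p\ge 1$, $$\inf_{\hat\mu\in\mathcal{S}_n}\ \sup_{\mu\in(\mu_0+\mathcal{C})\cap E_1}(\Pi^*\mu)^{\otimes n}\,\mathcal{N}^p(\hat\mu-\mu)\ \ge\ \sup\{\mathcal{N}^p(\mu):\mu\in\mathcal{C},\ \mu_0\pm\mu\in E_1\}\,(\Pi^*\mu_0 h)^n .$$
   Context: Let $(\mathcal{X},\mathcal{F})$ and $(\Theta,\mathcal{G})$ be measurable spaces and let $(\theta,A)\mapsto\pi_\theta(A)$, from $\Theta\times\mathcal{F}$ to $[0,1]$, be a probability kernel: $\theta\mapsto\pi_\theta(A)$ is measurable for all measurable $A\subseteq\mathcal{X}$, and $\pi_\theta(\cdot)$ is a probability measure on $(\mathcal{X},\mathcal{F})$ for all $\theta\in\Theta$. For a measure $\pi$ and a function $h$, write $\pi h:=\int h\,d\pi$. $\mathbb{M}(\mathcal{X},\mathcal{F})$ and $\mathbb{M}(\Theta,\mathcal{G})$ denote the sets of all signed finite measures on $(\mathcal{X},\mathcal{F})$ and $(\Theta,\mathcal{G})$. The linear operator $\Pi$ maps a real function $h$ on $\mathcal{X}$ to the real function $\Pi h(\theta)=\pi_\theta h$ on $\Theta$. Considering $\Pi$ acting on bounded functions, its adjoint $\Pi^*$ operates from $\mathbb{M}(\Theta,\mathcal{G})$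 to $\mathbb{M}(\mathcal{X},\mathcal{F})$ and is given by $\Pi^*\mu(A)=\mu\,\Pi\mathbf{1}_A$ for all $A\in\mathcal{F}$, where $\mathbf{1}_A$ is the indicator function of $A$ (for a probability measure $\mu$, $\Pi^*\mu$ is the mixture distribution with mixands $(\pi_\theta)$ and mixing distribution $\mu$). For a real function $h$ on $\mathcal{X}$, $M_h$ is the multiplication operator $M_hf(x)=h(x)f(x)$; considering it acting on bounded functions, its adjoint $M_h^*$ is the operator on $\mathbb{M}(\mathcal{X},\mathcal{F})$ given by $M_h^*\mu=\mu M_h$, i.e. $M_h^*\mu$ is the measure with density $h$ with respect to $\mu$. $E$ is a subspace of signed measures on $\Theta$, equipped with a semi-norm $\mathcal{N}$ and endowed with a $\sigma$-field which makes this semi-norm measurable. $E_1$ is the set of all probability measures that belong to $E$. $\mathcal{S}_n$ is the set of all $E$-valued estimators based on $n$ observations, that is, the set of all measurable functions $\hat\mu$ from $\mathcal{X}^n$ to $E$. $(\Pi^*\mu)^{\otimes n}$ is the $n$-fold product measure on $\mathcal{X}^n$, and $(\Pi^*\mu)^{\otimes n}\mathcal{N}^p(\hat\mu-\mu)$ denotes the integral of $(x_1,\dots,x_n)\mapsto\mathcal{N}(\hat\mu(x_1,\dots,x_n)-\mu)^p$ against it. *)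

theory Defs
  imports "HOL-Probability.Probability" "HOL-Library.Function_Algebras"
begin

text \<open>
  A finite signed measure on the measurable space \<open>M\<close> is a countably additive real-valued set
  function on \<open>sets M\<close>. Only the \<open>\<sigma>\<close>-algebra of \<open>M\<close> matters here. Values outside \<open>sets M\<close> are
  normalised to \<open>0\<close> (as for \<^const>\<open>measure\<close>), so that equality of set functions is equality of
  signed measures and the pointwise operations of Function-Algebras are the vector space operations.
\<close>

definition signed_measures :: "'a measure \<Rightarrow> ('a set \<Rightarrow> real) set" where
  "signed_measures M = {\<nu>. \<nu> {} = 0 \<and>
     (\<forall>A :: nat \<Rightarrow> 'a set. range A \<subseteq> sets M \<longrightarrow> disjoint_family A \<longrightarrow>
        (\<lambda>i. \<nu> (A i)) sums \<nu> (\<Union>i. A i)) \<and>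
     (\<forall>A. A \<notin> sets M \<longrightarrow> \<nu> A = 0)}"

abbreviation scale_signed :: "real \<Rightarrow> ('a set \<Rightarrow> real) \<Rightarrow> 'a set \<Rightarrow> real" where
  "scale_signed c \<nu> \<equiv> (\<lambda>A. c * \<nu> A)"

definition prob_measures :: "'a measure \<Rightarrow> ('a set \<Rightarrow> real) set" where
  "prob_measures M = measure ` space (prob_algebra M)"

text \<open>The converse of \<^const>\<open>measure\<close>, used for nonnegative \<open>\<nu>\<close> only.\<close>

definition as_measure :: "'a measure \<Rightarrow> ('a set \<Rightarrow> real) \<Rightarrow> 'a measure" where
  "as_measure M \<nu> = measure_of (space M) (sets M) (\<lambda>A. ennreal (\<nu> A))"

text \<open>
  The positive part of the Jordan decomposition; the negative part is \<open>upper_variation M (- \<nu>)\<close>.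
  Negative \<open>\<nu> B\<close> are truncated to \<open>0\<close> by \<^const>\<open>ennreal\<close>, which does not change the supremum
  since \<open>B = {}\<close> is admitted.
\<close>

definition upper_variation :: "'a measure \<Rightarrow> ('a set \<Rightarrow> real) \<Rightarrow> 'a measure" where
  "upper_variation M \<nu> =
     measure_of (space M) (sets M) (\<lambda>A. SUP B\<in>{B \<in> sets M. B \<subseteq> A}. ennreal (\<nu> B))"

definition signed_integral :: "'a measure \<Rightarrow> ('a set \<Rightarrow> real) \<Rightarrow> ('a \<Rightarrow> real) \<Rightarrow> real" where
  "signed_integral M \<nu> f =
     (\<integral>x. f x \<partial>upper_variation M \<nu>) - (\<integral>x. f x \<partial>upper_variation M (- \<nu>))"

text \<open>The operator \<open>\<Pi>\<close> of a kernel \<open>K\<close>, its adjoint, and the adjoint of multiplication by \<open>h\<close>.\<close>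

definition kernel_op :: "('t \<Rightarrow> 'x measure) \<Rightarrow> ('x \<Rightarrow> real) \<Rightarrow> 't \<Rightarrow> real" where
  "kernel_op K h = (\<lambda>\<theta>. \<integral>x. h x \<partial>K \<theta>)"

definition kernel_adjoint ::
  "'t measure \<Rightarrow> 'x measure \<Rightarrow> ('t \<Rightarrow> 'x measure) \<Rightarrow> ('t set \<Rightarrow> real) \<Rightarrow> 'x set \<Rightarrow> real" where
  "kernel_adjoint \<Theta> X K \<mu> =
     (\<lambda>A. if A \<in> sets X then signed_integral \<Theta> \<mu> (kernel_op K (indicator A)) else 0)"

definition mult_op :: "('x \<Rightarrow> real) \<Rightarrow> ('x \<Rightarrow> real) \<Rightarrow> 'x \<Rightarrow> real" where
  "mult_op h f = (\<lambda>x. h x * f x)"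

definition mult_adjoint ::
  "'x measure \<Rightarrow> ('x \<Rightarrow> real) \<Rightarrow> ('x set \<Rightarrow> real) \<Rightarrow> 'x set \<Rightarrow> real" where
  "mult_adjoint X h \<nu> =
     (\<lambda>A. if A \<in> sets X then signed_integral X \<nu> (mult_op h (indicator A)) else 0)"

definition seminorm_on :: "('a set \<Rightarrow> real) set \<Rightarrow> (('a set \<Rightarrow> real) \<Rightarrow> real) \<Rightarrow> bool" where
  "seminorm_on E N \<longleftrightarrow>
     (\<forall>\<mu>\<in>E. 0 \<le> N \<mu>) \<and>
     (\<forall>c. \<forall>\<mu>\<in>E. N (scale_signed c \<mu>) = \<bar>c\<bar> * N \<mu>) \<and>
     (\<forall>\<mu>\<in>E. \<forall>\<nu>\<in>E. N (\<mu> + \<nu>) \<le> N \<mu> + N \<nu>)"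

text \<open>
  Measurability of a seminorm \<open>N\<close> does not imply measurability of its translates \<open>\<nu> \<mapsto> N (\<nu> - \<mu>)\<close>,
  whose integrals are the risks of estimators. \<^const>\<open>nn_integral\<close> is the lower integral on
  non-measurable functions; the risk is defined by the upper integral. On measurable
  functions both are the usual integral (\<open>upper_nn_integral_eq\<close>).
\<close>

definition upper_nn_integral :: "'a measure \<Rightarrow> ('a \<Rightarrow> ennreal) \<Rightarrow> ennreal" where
  "upper_nn_integral M f =
     (INF g\<in>{g \<in> borel_measurable M. \<forall>x\<in>space M. f x \<le> g x}. \<integral>\<^sup>+x. g x \<partial>M)"

lemma upper_nn_integral_eq:
  assumes "f \<in> borel_measurable M"
  shows "upper_nn_integral M f = (\<integral>\<^sup>+x. f x \<partial>M)"
  unfolding upper_nn_integral_def using assms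
  by (intro antisym INF_lower2[of f] INF_greatest nn_integral_mono) auto

definition risk ::
  "'t measure \<Rightarrow> 'x measure \<Rightarrow> ('t \<Rightarrow> 'x measure) \<Rightarrow> (('t set \<Rightarrow> real) \<Rightarrow> real) \<Rightarrow> real \<Rightarrow> nat \<Rightarrow>
   ((nat \<Rightarrow> 'x) \<Rightarrow> 't set \<Rightarrow> real) \<Rightarrow> ('t set \<Rightarrow> real) \<Rightarrow> ennreal" where
  "risk \<Theta> X K N p n \<mu>' \<mu> =
     upper_nn_integral (PiM {..<n} (\<lambda>_. as_measure X (kernel_adjoint \<Theta> X K \<mu>)))
       (\<lambda>x. ennreal (N (\<mu>' x - \<mu>) powr p))"

lemma as_measure_measure:
  assumes "finite_measure P" "sets P = sets M"
  shows "as_measure M (measure P) = P"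
proof -
  interpret finite_measure P by fact
  have "as_measure M (measure P) = measure_of (space P) (sets P) (emeasure P)"
    using assms(2) sets_eq_imp_space_eq[OF assms(2)]
    by (simp add: as_measure_def emeasure_eq_measure[abs_def])
  then show ?thesis by (simp add: measure_of_of_measure)
qed

lemma signed_integral_measure:
  assumes "finite_measure P" "sets P = sets M"
  shows "signed_integral M (measure P) f = (\<integral>x. f x \<partial>P)"
proof -
  interpret finite_measure P by fact
  have sp: "space M = space P" using sets_eq_imp_space_eq[OF assms(2)] by simp
  have "upper_variation M (measure P) = measure_of (space P) (sets P) (emeasure P)"
    unfolding upper_variation_def sp assms(2)[symmetric]
  proof (rule measure_of_eq[OF sets.space_closed])
    fix A assume "A \<in> sigma_sets (space P) (sets P)"
    then have "A \<in> sets P" by (simp add: sets.sigma_sets_eq)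
    then show "(SUP B\<in>{B \<in> sets P. B \<subseteq> A}. ennreal (measure P B)) = emeasure P A"
      by (intro antisym SUP_least SUP_upper2[of A])
         (auto simp: emeasure_eq_measure[symmetric] intro!: emeasure_mono)
  qed
  then have 1: "upper_variation M (measure P) = P" by (simp add: measure_of_of_measure)
  have "upper_variation M (- measure P) = measure_of (space P) (sets P) (\<lambda>_. 0)"
    unfolding upper_variation_def sp assms(2)[symmetric]
  proof (rule measure_of_eq[OF sets.space_closed])
    fix A
    show "(SUP B\<in>{B \<in> sets P. B \<subseteq> A}. ennreal ((- measure P) B)) = 0"
      by (intro antisym SUP_least) (auto simp: ennreal_neg)
  qed
  also have "\<dots> = null_measure P" by (simp add: null_measure_def)
  finally show ?thesis by (simp add: signed_integral_def 1)
qed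

end

theory Submission
  imports Defs
begin

text \<open>
  The risks at \<open>\<mu>\<^sub>0 + \<mu>\<close> and \<open>\<mu>\<^sub>0 - \<mu>\<close> are bounded from below together. As \<open>\<mu>\<close> and \<open>- \<mu>\<close> lie in
  the kernel of \<open>M\<^sub>h\<^sup>* \<circ> \<Pi>\<^sup>*\<close>, the mixtures with mixing distributions \<open>\<mu>\<^sub>0\<close>, \<open>\<mu>\<^sub>0 + \<mu>\<close> and \<open>\<mu>\<^sub>0 - \<mu>\<close>
  become the same measure after multiplication by \<open>h\<close>. Since \<open>h \<le> 1\<close>, the \<open>n\<close>-fold product of this
  measure, whose total mass is \<open>(\<Pi>\<^sup>*\<mu>\<^sub>0 h)\<^sup>n\<close>, is dominated by both \<open>n\<close>-fold products of mixtures.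
  On it the two losses add up, pointwise, to at least \<open>2 N(\<mu>)\<^sup>p\<close>, by the triangle inequality
  and convexity of \<open>t \<mapsto> t\<^sup>p\<close>.
\<close>

section \<open>Convexity of powers\<close>

lemma powr_midpoint_le:
  fixes a b p :: real
  assumes "0 \<le> a" "0 \<le> b" "1 \<le> p"
  shows "((a + b) / 2) powr p \<le> (a powr p + b powr p) / 2"
proof -
  have half: "(c / 2) powr p \<le> c powr p / 2" if "0 \<le> c" for c :: real
  proof -
    have "2 powr 1 \<le> (2::real) powr p"
      using assms(3) by (intro powr_mono) auto
    then have "c powr p / 2 powr p \<le> c powr p / 2"
      by (intro divide_left_mono) auto
    then show ?thesis
      using that by (simp add: powr_divide)
  qed
  show ?thesis
  \<comment> \<open>Convexity is invoked for two positive numbers only. If one of them is zero, the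
    claim is \<open>half\<close> for the other, which rests on 2 \<le>
    \<open>2 powr p\<close>.\<close>
  proof (cases "a = 0 \<or> b = 0")
    case True
    then show ?thesis using half[of a] half[of b] assms by auto
  next
    case False
    then show ?thesis
      using convex_onD[OF powr_convex[OF assms(3)], of "1/2" a b] assms by (simp add: field_simps)
  qed
qed

section \<open>Differences of finite measures and their signed integrals\<close>

text \<open>An identity between differences of measures, written additively so that no possibly
  infinite integrals are subtracted. It passes from sets to functions by the usual induction over
  simple functions and monotone limits.\<close>

lemma nn_integral_add_measures_eq:
  assumes "sets B = sets A" "sets C = sets A" "sets D = sets A"
    and eq: "\<And>S. S \<in> sets A \<Longrightarrow> emeasure A S + emeasure B S = emeasure C S + emeasure D S"
    and f: "f \<in> borel_measurable A"
  shows "integral\<^sup>N A f + integral\<^sup>N B f = integral\<^sup>N C f + integral\<^sup>N D f"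
proof -
  note [measurable_cong] = assms(1-3)
  have sp: "space B = space A" "space C = space A" "space D = space A"
    using assms(1-3) by (auto dest: sets_eq_imp_space_eq)
  from f show ?thesis
  proof induction
    case (cong f g)
    then have "integral\<^sup>N M f = integral\<^sup>N M g" if "space M = space A" for M :: "'a measure"
      using that by (intro nn_integral_cong) auto
    with cong sp show ?case by simp
  next
    case (set S)
    then show ?case using assms by simp
  next
    case (mult u c)
    then show ?case by (simp add: nn_integral_cmult distrib_left[symmetric])
  next
    case (add u v)
    then show ?case by (simp add: nn_integral_add) (metis (no_types, lifting) add.assoc add.left_commute)
  next
    case (seq U)
    have SUP_eq: "(SUP i. U i) = (\<lambda>x. SUP i. U i x)" by (simp add: fun_eq_iff image_comp)
    have SUP: "integral\<^sup>N M (\<lambda>x. SUP i. U i x) = (SUP i. integral\<^sup>N M (U i))"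
      if [measurable_cong]: "sets M = sets A" for M
      using seq by (intro nn_integral_monotone_convergence_SUP) auto
    \<comment> \<open>Monotonicity is what allows the two suprema on each side to be added
      termwise.\<close>
    have inc: "incseq (\<lambda>i. integral\<^sup>N M (U i))" for M :: "'a measure"
      using seq by (auto simp: incseq_def le_fun_def intro!: nn_integral_mono)
    show ?case
      using assms(1-3) seq.IH unfolding SUP_eq by (simp add: SUP ennreal_SUP_add[symmetric] inc)
  qed
qed

text \<open>\<open>Y\<close> is the positive set of a Hahn decomposition of P - Q, so the supremum
  defining the upper variation at \<open>A\<close> is attained at
  \<open>A \<inter> Y\<close>.\<close>

lemma emeasure_upper_variation_diff:
  assumes "finite_measure P" "finite_measure Q" and sets: "sets P = sets M" "sets Q = sets M"
    and Y: "Y \<in> sets M"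
    and pos: "\<And>A. A \<in> sets M \<Longrightarrow> A \<subseteq> Y \<Longrightarrow> measure Q A \<le> measure P A"
    and neg: "\<And>A. A \<in> sets M \<Longrightarrow> A \<inter> Y = {} \<Longrightarrow> measure P A \<le> measure Q A"
    and A: "A \<in> sets M"
  shows "emeasure (upper_variation M (measure P - measure Q)) A =
    ennreal (measure P (A \<inter> Y) - measure Q (A \<inter> Y))"
proof -
  interpret P: finite_measure P by fact
  interpret Q: finite_measure Q by fact
  \<comment> \<open>The restrictions of P and Q to \<open>Y\<close>. There Q is dominated by P, so
    their difference is again a measure.\<close>
  define PY QY where "PY = density P (indicator Y)" and "QY = density Q (indicator Y)"
  have emeasure_PY: "emeasure PY B = ennreal (measure P (B \<inter> Y))"
    and emeasure_QY: "emeasure QY B = ennreal (measure Q (B \<inter> Y))" if "B \<in> sets M" for B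
    using that Y sets unfolding PY_def QY_def
    by (simp_all add: emeasure_density nn_integral_indicator Int_commute
        P.emeasure_eq_measure[symmetric] Q.emeasure_eq_measure[symmetric]
        flip: indicator_inter_arith)
  have [simp]: "sets PY = sets M" "sets QY = sets M" "space PY = space M"
    using sets sets_eq_imp_space_eq[OF sets(1)] by (auto simp: PY_def QY_def)
  have fin: "finite_measure PY" "finite_measure QY"
    using sets_eq_imp_space_eq[of QY M]
    by (auto intro!: finite_measureI simp: emeasure_PY emeasure_QY)
  have diff: "emeasure PY B - emeasure QY B = ennreal (measure P (B \<inter> Y) - measure Q (B \<inter> Y))"
    if "B \<in> sets M" for B
    using that by (simp add: emeasure_PY emeasure_QY ennreal_minus)
  \<comment> \<open>Passing from \<open>B\<close> to \<open>S \<inter> Y\<close> removes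
    \<open>B - Y\<close>, where P - Q is nonpositive, and adds \<open>S \<inter> Y - B\<close>,
    where it is nonnegative.\<close>
  have mono: "measure P B - measure Q B \<le> measure P (S \<inter> Y) - measure Q (S \<inter> Y)"
    if B: "B \<in> sets M" "S \<in> sets M" "B \<subseteq> S" for B S
  proof -
    have split: "measure R C = measure R (C \<inter> Z) + measure R (C - Z)"
      if "finite_measure R" "sets R = sets M" "C \<in> sets M" "Z \<in> sets M"
      for R :: "'a measure" and C Z
    proof -
      interpret R: finite_measure R by fact
      show ?thesis
        using that R.finite_measure_Union[of "C \<inter> Z" "C - Z"]
        by (simp add: Int_Diff_Un Int_Diff_disjoint)
    qed
    have SB: "(S \<inter> Y) \<inter> B = B \<inter> Y" using B by auto
    have "measure P (B - Y) \<le> measure Q (B - Y)"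
      using B Y by (intro neg) auto
    moreover have "measure Q (S \<inter> Y - B) \<le> measure P (S \<inter> Y - B)"
      using B Y by (intro pos) auto
    moreover have "measure R B - measure R (S \<inter> Y) = measure R (B - Y) - measure R (S \<inter> Y - B)"
      if "finite_measure R" "sets R = sets M" for R
      using split[OF that B(1) Y] split[OF that, of "S \<inter> Y" B] B Y unfolding SB by simp
    from this[OF assms(1) sets(1)] this[OF assms(2) sets(2)] calculation
    show ?thesis by linarith
  qed
  \<comment> \<open>\<open>measure_of\<close> returns the given set function only if it is countably
    additive. Identifying the supremum with a difference of measures supplies this.\<close>
  have "upper_variation M (measure P - measure Q) = diff_measure PY QY"
    unfolding upper_variation_def diff_measure_def \<open>sets PY = sets M\<close> \<open>space PY = space M\<close>
  proof (rule measure_of_eq[OF sets.space_closed])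
    fix S assume "S \<in> sigma_sets (space M) (sets M)"
    then have S: "S \<in> sets M" by (simp add: sets.sigma_sets_eq)
    show "(SUP B\<in>{B \<in> sets M. B \<subseteq> S}. ennreal ((measure P - measure Q) B)) =
        emeasure PY S - emeasure QY S"
      unfolding diff[OF S] using S Y
      by (intro antisym SUP_least SUP_upper2[of "S \<inter> Y"]) (auto intro!: ennreal_leI mono)
  qed
  also have "emeasure \<dots> A = emeasure PY A - emeasure QY A"
    using A Y pos by (intro emeasure_diff_measure fin) (auto simp: emeasure_PY emeasure_QY intro!: ennreal_leI)
  finally show ?thesis using A by (simp add: diff)
qed

text \<open>P and Q need not be the Jordan parts of P - Q. With \<open>U\<close> and
  \<open>V\<close> the Jordan parts, U - V = P - Q, that is U + Q = V + P; integrating and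
  cancelling finite integrals gives the claim.\<close>

lemma signed_integral_diff:
  assumes "finite_measure P" "finite_measure Q" and sets: "sets P = sets M" "sets Q = sets M"
    and f[measurable]: "f \<in> borel_measurable M"
    and bounds: "\<And>x. x \<in> space M \<Longrightarrow> 0 \<le> f x \<and> f x \<le> B"
  shows "signed_integral M (measure P - measure Q) f = (\<integral>x. f x \<partial>P) - (\<integral>x. f x \<partial>Q)"
proof -
  interpret P: finite_measure P by fact
  interpret Q: finite_measure Q by fact
  obtain Y where Y: "Y \<in> sets M"
    and pos: "\<And>A. A \<in> sets M \<Longrightarrow> A \<subseteq> Y \<Longrightarrow> measure Q A \<le> measure P A"
    and neg: "\<And>A. A \<in> sets M \<Longrightarrow> A \<inter> Y = {} \<Longrightarrow> measure P A \<le> measure Q A"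
    using finite_unsigned_Hahn_decomposition[OF assms(1,2)] sets
    by (auto simp: P.emeasure_eq_measure Q.emeasure_eq_measure)
  define U V where "U = upper_variation M (measure P - measure Q)"
    and "V = upper_variation M (measure Q - measure P)"
  have [simp, measurable_cong]: "sets U = sets M" "sets V = sets M"
    by (auto simp: U_def V_def upper_variation_def)
  note [measurable_cong] = sets
  have eU: "emeasure U A = ennreal (measure P (A \<inter> Y) - measure Q (A \<inter> Y))"
    if "A \<in> sets M" for A
    unfolding U_def by (rule emeasure_upper_variation_diff[OF assms(1-4) Y pos neg that])
  \<comment> \<open>The complement of \<open>Y\<close> is a positive set for Q - P.\<close>
  have eV: "emeasure V A = ennreal (measure Q (A \<inter> (space M - Y)) - measure P (A \<inter> (space M - Y)))"
    if "A \<in> sets M" for A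
    unfolding V_def using Y sets.sets_into_space
    by (intro emeasure_upper_variation_diff[OF assms(2,1,4,3)] that pos neg) blast+
  have fin: "finite_measure U" "finite_measure V"
    using sets_eq_imp_space_eq[of U M] sets_eq_imp_space_eq[of V M]
    by (auto intro!: finite_measureI simp: eU eV)
  have "emeasure U A + emeasure Q A = emeasure V A + emeasure P A" if A: "A \<in> sets U" for A
  proof -
    have split: "measure R A = measure R (A \<inter> Y) + measure R (A \<inter> (space M - Y))"
      if "finite_measure R" "sets R = sets M" for R :: "'a measure"
    proof -
      interpret R: finite_measure R by fact
      have "A = A \<inter> Y \<union> A \<inter> (space M - Y)"
        using sets.sets_into_space[OF A] sets_eq_imp_space_eq[of U M] by auto
      moreover have "(A \<inter> Y) \<inter> (A \<inter> (space M - Y)) = {}" by auto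
      ultimately show ?thesis
        using that A Y R.finite_measure_Union[of "A \<inter> Y" "A \<inter> (space M - Y)"] by auto
    qed
    have "0 \<le> measure P (A \<inter> Y) - measure Q (A \<inter> Y)"
      "0 \<le> measure Q (A \<inter> (space M - Y)) - measure P (A \<inter> (space M - Y))"
      using A Y pos[of "A \<inter> Y"] neg[of "A \<inter> (space M - Y)"] by auto
    then show ?thesis
      using A split[OF assms(1) sets(1)] split[OF assms(2) sets(2)]
      by (simp add: eU eV P.emeasure_eq_measure Q.emeasure_eq_measure flip: ennreal_plus)
  qed
  then have nn: "integral\<^sup>N U f + integral\<^sup>N Q f = integral\<^sup>N V f + integral\<^sup>N P f"
    using sets by (intro nn_integral_add_measures_eq) auto
  \<comment> \<open>Boundedness of \<open>f\<close> makes all four integrals finite, so that the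
    additive identity can be read in the reals and rearranged.\<close>
  have int: "integral\<^sup>N R f = ennreal (\<integral>x. f x \<partial>R) \<and> 0 \<le> (\<integral>x. f x \<partial>R)"
    if "finite_measure R" and [measurable_cong]: "sets R = sets M" for R
  proof -
    interpret R: finite_measure R by fact
    have sp: "space R = space M" using that by (auto dest: sets_eq_imp_space_eq)
    have "integrable R f"
      using bounds by (intro R.integrable_const_bound[of _ B]) (auto simp: sp)
    then show ?thesis
      using bounds by (auto intro!: nn_integral_eq_integral integral_nonneg_AE simp: sp)
  qed
  have "(\<integral>x. f x \<partial>U) + (\<integral>x. f x \<partial>Q) = (\<integral>x. f x \<partial>V) + (\<integral>x. f x \<partial>P)"
    using nn int[OF fin(1)] int[OF fin(2)] int[OF assms(1) sets(1)] int[OF assms(2) sets(2)]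
    by (auto simp flip: ennreal_plus)
  then show ?thesis
    by (simp add: signed_integral_def U_def V_def)
qed

section \<open>Mixtures and the adjoint operators\<close>

lemma bind_in_prob_algebra:
  assumes "K \<in> \<Theta> \<rightarrow>\<^sub>M prob_algebra X" "R \<in> space (prob_algebra \<Theta>)"
  shows "R \<bind> K \<in> space (prob_algebra X)"
  using measurable_space[OF measurable_bind_prob_space[OF measurable_ident assms(1)] assms(2)]
  by simp

lemma kernel_op_indicator_measurable:
  assumes K: "K \<in> \<Theta> \<rightarrow>\<^sub>M prob_algebra X" and A: "A \<in> sets X"
  shows "kernel_op K (indicator A) \<in> borel_measurable \<Theta>"
    and "\<theta> \<in> space \<Theta> \<Longrightarrow> kernel_op K (indicator A) \<theta> = measure (K \<theta>) A"
proof -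
  have *: "kernel_op K (indicator A) \<theta> = measure (K \<theta>) A" if "\<theta> \<in> space \<Theta>" for \<theta>
    using measurable_space[OF K that] A by (simp add: kernel_op_def space_prob_algebra)
  show "kernel_op K (indicator A) \<in> borel_measurable \<Theta>"
    using measurable_compose[OF measurable_prob_algebraD[OF K] measurable_measure_subprob_algebra[OF A]]
    by (simp add: * cong: measurable_cong)
  show "\<theta> \<in> space \<Theta> \<Longrightarrow> kernel_op K (indicator A) \<theta> = measure (K \<theta>) A" by (rule *)
qed

lemma integral_kernel_op_indicator:
  assumes K: "K \<in> \<Theta> \<rightarrow>\<^sub>M prob_algebra X" and A: "A \<in> sets X"
    and R: "R \<in> space (prob_algebra \<Theta>)"
  shows "(\<integral>\<theta>. kernel_op K (indicator A) \<theta> \<partial>R) = measure (R \<bind> K) A"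
proof -
  have sets: "sets R = sets \<Theta>" and "prob_space R" using R by (auto simp: space_prob_algebra)
  then interpret prob_space R by simp
  have "K \<in> R \<rightarrow>\<^sub>M subprob_algebra X"
    using measurable_prob_algebraD[OF K] sets by (simp cong: measurable_cong_sets)
  then have "measure (R \<bind> K) A = (\<integral>\<theta>. measure (K \<theta>) A \<partial>R)"
    using A by (rule measure_bind)
  also have "\<dots> = (\<integral>\<theta>. kernel_op K (indicator A) \<theta> \<partial>R)"
    using sets_eq_imp_space_eq[OF sets] kernel_op_indicator_measurable(2)[OF K A]
    by (intro Bochner_Integration.integral_cong) auto
  finally show ?thesis by simp
qed

lemma measure_notin_prob_algebra:
  "P \<in> space (prob_algebra X) \<Longrightarrow> A \<notin> sets X \<Longrightarrow> measure P A = 0"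
  by (auto simp: space_prob_algebra measure_notin_sets)

lemma prob_algebraD:
  assumes "P \<in> space (prob_algebra X)"
  shows "prob_space P" "finite_measure P" "sets P = sets X"
  using assms by (auto simp: space_prob_algebra prob_space_def)

lemma kernel_adjoint_measure:
  assumes K: "K \<in> \<Theta> \<rightarrow>\<^sub>M prob_algebra X" and R: "R \<in> space (prob_algebra \<Theta>)"
  shows "kernel_adjoint \<Theta> X K (measure R) = measure (R \<bind> K)"
  using signed_integral_measure[OF prob_algebraD(2,3)[OF R]] measure_notin_prob_algebra[OF bind_in_prob_algebra[OF K R]]
  by (auto simp: kernel_adjoint_def integral_kernel_op_indicator[OF K _ R])

text \<open>The relevant perturbations have the form
  \<open>(\<mu>\<^sub>0 + \<mu>) - \<mu>\<^sub>0\<close> with both terms probability measures, so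
  linearity of the adjoint is only required on such differences.\<close>

lemma kernel_adjoint_diff:
  assumes K: "K \<in> \<Theta> \<rightarrow>\<^sub>M prob_algebra X"
    and R: "R \<in> space (prob_algebra \<Theta>)" and S: "S \<in> space (prob_algebra \<Theta>)"
  shows "kernel_adjoint \<Theta> X K (measure R - measure S) = measure (R \<bind> K) - measure (S \<bind> K)"
proof
  fix A
  show "kernel_adjoint \<Theta> X K (measure R - measure S) A = (measure (R \<bind> K) - measure (S \<bind> K)) A"
  proof (cases "A \<in> sets X")
    case True
    have "0 \<le> kernel_op K (indicator A) \<theta> \<and> kernel_op K (indicator A) \<theta> \<le> 1"
      if "\<theta> \<in> space \<Theta>" for \<theta>
      using measurable_space[OF K that] kernel_op_indicator_measurable(2)[OF K True that]
      by (simp add: space_prob_algebra prob_space.prob_le_1)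
    with True show ?thesis
      using signed_integral_diff[OF prob_algebraD(2)[OF R] prob_algebraD(2)[OF S]
          prob_algebraD(3)[OF R] prob_algebraD(3)[OF S] kernel_op_indicator_measurable(1)[OF K True], of 1]
      by (simp add: kernel_adjoint_def integral_kernel_op_indicator[OF K _ R]
          integral_kernel_op_indicator[OF K _ S])
  next
    \<comment> \<open>Outside \<open>sets X\<close> both sides take the default value zero.\<close>
    case False
    then show ?thesis
      using measure_notin_prob_algebra[OF bind_in_prob_algebra[OF K R]]
        measure_notin_prob_algebra[OF bind_in_prob_algebra[OF K S]]
      by (simp add: kernel_adjoint_def)
  qed
qed

text \<open>At a measurable \<open>A\<close>, the adjoint is the integral of \<open>h\<close> over
  \<open>A\<close> under P minus the one under Q. Its vanishing says that the two measures with
  density \<open>h\<close> agree on \<open>A\<close>.\<close>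

lemma density_eq_if_mult_adjoint_eq_0:
  assumes "finite_measure P" "finite_measure Q" and sets: "sets P = sets X" "sets Q = sets X"
    and h[measurable]: "h \<in> borel_measurable X"
    and bounds: "\<And>x. x \<in> space X \<Longrightarrow> 0 \<le> h x \<and> h x \<le> B"
    and zero: "mult_adjoint X h (measure P - measure Q) = 0"
  shows "density P h = density Q h"
proof (rule measure_eqI)
  show "sets (density P h) = sets (density Q h)" using sets by simp
  note [measurable_cong] = sets
  fix A assume "A \<in> sets (density P h)"
  then have A[measurable]: "A \<in> sets X" using sets by simp
  have [measurable]: "mult_op h (indicator A) \<in> borel_measurable X"
    unfolding mult_op_def by measurable
  have b: "0 \<le> mult_op h (indicator A) x \<and> mult_op h (indicator A) x \<le> B" if "x \<in> space X" for x
    using bounds[OF that] by (auto simp: mult_op_def indicator_def)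
  have eq: "emeasure (density R h) A = ennreal (\<integral>x. mult_op h (indicator A) x \<partial>R)"
    if "finite_measure R" and [measurable_cong]: "sets R = sets X" for R
  proof -
    interpret R: finite_measure R by fact
    have sp: "space R = space X" using that by (auto dest: sets_eq_imp_space_eq)
    have "integrable R (mult_op h (indicator A))"
      using b by (intro R.integrable_const_bound[of _ B]) (auto simp: sp)
    then have "(\<integral>\<^sup>+x. mult_op h (indicator A) x \<partial>R) = ennreal (\<integral>x. mult_op h (indicator A) x \<partial>R)"
      using b by (intro nn_integral_eq_integral) (auto simp: sp)
    then show ?thesis
      using that by (simp add: emeasure_density mult_op_def ennreal_mult'' ennreal_indicator)
  qed
  have "signed_integral X (measure P - measure Q) (mult_op h (indicator A)) = 0"
    using fun_cong[OF zero, of A] A by (simp add: mult_adjoint_def)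
  then have "(\<integral>x. mult_op h (indicator A) x \<partial>P) = (\<integral>x. mult_op h (indicator A) x \<partial>Q)"
    using signed_integral_diff[OF assms(1-4) _ b] by simp
  then show "emeasure (density P h) A = emeasure (density Q h) A"
    using eq[OF assms(1) sets(1)] eq[OF assms(2) sets(2)] by simp
qed

section \<open>Products of measures with densities\<close>

text \<open>By uniqueness of the product measure it suffices to compare on rectangles, where the
  integral of the product density factorises.\<close>

lemma PiM_density:
  assumes "finite I" "product_sigma_finite M" "product_sigma_finite (\<lambda>i. density (M i) (h i))"
    and h[measurable]: "\<And>i. i \<in> I \<Longrightarrow> h i \<in> borel_measurable (M i)"
  shows "PiM I (\<lambda>i. density (M i) (h i)) = density (PiM I M) (\<lambda>x. \<Prod>i\<in>I. h i (x i))"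
proof -
  interpret M: product_sigma_finite M by fact
  interpret D: product_sigma_finite "\<lambda>i. density (M i) (h i)" by fact
  have meas[measurable]: "(\<lambda>x. \<Prod>i\<in>I. h i (x i)) \<in> borel_measurable (PiM I M)"
    by measurable
  show ?thesis
  proof (rule D.PiM_eqI[symmetric, OF assms(1)])
    show "sets (density (PiM I M) (\<lambda>x. \<Prod>i\<in>I. h i (x i))) = sets (PiM I (\<lambda>i. density (M i) (h i)))"
      by (simp cong: sets_PiM_cong)
    fix A assume A: "\<And>i. i \<in> I \<Longrightarrow> A i \<in> sets (density (M i) (h i))"
    then have [measurable]: "i \<in> I \<Longrightarrow> A i \<in> sets (M i)" for i by simp
    have PiE: "Pi\<^sub>E I A \<in> sets (PiM I M)"
      using assms(1) A by (intro sets_PiM_I_finite) auto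
    \<comment> \<open>The restriction to the space matters: membership in
      \<open>Pi\<^sub>E I A\<close> also demands the default value outside \<open>I\<close>, which
      the factors do not see.\<close>
    have ind: "indicator (Pi\<^sub>E I A) x = (\<Prod>i\<in>I. indicator (A i) (x i) :: ennreal)"
      if "x \<in> space (PiM I M)" for x
      using that assms(1) by (auto simp: indicator_def space_PiM PiE_def Pi_def prod_zero_iff)
    have "emeasure (density (PiM I M) (\<lambda>x. \<Prod>i\<in>I. h i (x i))) (Pi\<^sub>E I A) =
        (\<integral>\<^sup>+x. (\<Prod>i\<in>I. h i (x i)) * indicator (Pi\<^sub>E I A) x \<partial>PiM I M)"
      using PiE by (simp add: emeasure_density)
    also have "\<dots> = (\<integral>\<^sup>+x. (\<Prod>i\<in>I. h i (x i) * indicator (A i) (x i)) \<partial>PiM I M)"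
      by (intro nn_integral_cong) (simp add: ind prod.distrib)
    also have "\<dots> = (\<Prod>i\<in>I. \<integral>\<^sup>+x. h i x * indicator (A i) x \<partial>M i)"
      using assms(1) by (intro M.product_nn_integral_prod) auto
    also have "\<dots> = (\<Prod>i\<in>I. emeasure (density (M i) (h i)) (A i))"
      by (intro prod.cong) (simp_all add: emeasure_density)
    finally show "emeasure (density (PiM I M) (\<lambda>x. \<Prod>i\<in>I. h i (x i))) (Pi\<^sub>E I A) =
      (\<Prod>i\<in>I. emeasure (density (M i) (h i)) (A i))" .
  qed
qed

lemma emeasure_density_space:
  "h \<in> borel_measurable M \<Longrightarrow> emeasure (density M h) (space M) = (\<integral>\<^sup>+x. h x \<partial>M)"
  by (auto simp: emeasure_density intro!: nn_integral_cong)

lemma finite_measure_density_le_1: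
  assumes "finite_measure M" "h \<in> borel_measurable M"
    and le: "\<And>x. x \<in> space M \<Longrightarrow> h x \<le> (1::ennreal)"
  shows "finite_measure (density M h)"
proof -
  interpret finite_measure M by fact
  have "(\<integral>\<^sup>+x. h x \<partial>M) \<le> (\<integral>\<^sup>+x. 1 \<partial>M)"
    using le by (intro nn_integral_mono)
  also have "\<dots> < \<top>" by (simp add: emeasure_eq_measure)
  finally show ?thesis
    using assms(2) by (auto intro!: finite_measureI simp: emeasure_density_space)
qed

text \<open>The product of the measures \<open>density P h\<close> has a density with respect to the
  product of P that is a product of factors at most 1. This turns h \<le> 1 into a lower bound for
  integrals under the mixtures.\<close>

lemma nn_integral_PiM_density_le:
  assumes "finite I" "prob_space P" and h[measurable]: "h \<in> borel_measurable P"
    and le: "\<And>x. x \<in> space P \<Longrightarrow> h x \<le> (1::ennreal)"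
    and g: "g \<in> borel_measurable (PiM I (\<lambda>_. P))"
  shows "(\<integral>\<^sup>+x. g x \<partial>PiM I (\<lambda>_. density P h)) \<le> (\<integral>\<^sup>+x. g x \<partial>PiM I (\<lambda>_. P))"
proof -
  interpret P: prob_space P by fact
  interpret D: finite_measure "density P h"
    using P.finite_measure_axioms h le by (rule finite_measure_density_le_1)
  have "PiM I (\<lambda>_. density P h) = density (PiM I (\<lambda>_. P)) (\<lambda>x. \<Prod>i\<in>I. h (x i))"
    by (rule PiM_density[OF assms(1)])
      (auto simp: product_sigma_finite_def P.sigma_finite_measure_axioms D.sigma_finite_measure_axioms)
  then have "(\<integral>\<^sup>+x. g x \<partial>PiM I (\<lambda>_. density P h)) =
      (\<integral>\<^sup>+x. (\<Prod>i\<in>I. h (x i)) * g x \<partial>PiM I (\<lambda>_. P))"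
    using g by (simp add: nn_integral_density)
  also have "\<dots> \<le> (\<integral>\<^sup>+x. g x \<partial>PiM I (\<lambda>_. P))"
  proof (rule nn_integral_mono)
    fix x assume "x \<in> space (PiM I (\<lambda>_. P))"
    then have "(\<Prod>i\<in>I. h (x i)) \<le> 1"
      using le by (intro prod_le_1) (auto simp: space_PiM PiE_def Pi_def)
    from mult_right_mono[OF this, of "g x"] show "(\<Prod>i\<in>I. h (x i)) * g x \<le> g x" by simp
  qed
  finally show ?thesis .
qed

section \<open>Two-point bound for upper integrals\<close>

lemma upper_nn_integral_lessE:
  assumes "upper_nn_integral M f < t"
  obtains g where "g \<in> borel_measurable M" "\<And>x. x \<in> space M \<Longrightarrow> f x \<le> g x"
    "(\<integral>\<^sup>+x. g x \<partial>M) < t"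
  using assms unfolding upper_nn_integral_def INF_less_iff by blast

text \<open>The losses \<open>f\<close> and \<open>f'\<close> are not assumed measurable, and the
  upper integral is not additive. The argument therefore adds measurable majorants of the two
  losses, integrated over the common measure.\<close>

lemma two_point_bound:
  fixes a :: ennreal
  assumes "prob_space P" "prob_space P'" "prob_space Q"
    and sets: "sets P = sets X" "sets P' = sets X" "sets Q = sets X"
    and h: "h \<in> borel_measurable X"
    and le: "\<And>x. x \<in> space X \<Longrightarrow> h x \<le> (1::ennreal)"
    and common: "density P h = density Q h" "density P' h = density Q h"
    and I: "finite I"
    and f: "\<And>x. x \<in> space (PiM I (\<lambda>_. X)) \<Longrightarrow> 2 * a \<le> f x + f' x"
  shows "a * (\<integral>\<^sup>+x. h x \<partial>Q) ^ card I \<le>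
    max (upper_nn_integral (PiM I (\<lambda>_. P)) f) (upper_nn_integral (PiM I (\<lambda>_. P')) f')"
proof (rule ccontr)
  define D where "D = PiM I (\<lambda>_. density Q h)"
  have sets_D: "sets D = sets (PiM I (\<lambda>_. X))"
    using sets(3) by (auto simp: D_def cong: sets_PiM_cong)
  assume "\<not> ?thesis"
  then have "max (upper_nn_integral (PiM I (\<lambda>_. P)) f) (upper_nn_integral (PiM I (\<lambda>_. P')) f')
      < a * (\<integral>\<^sup>+x. h x \<partial>Q) ^ card I"
    by (rule not_le_imp_less)
  \<comment> \<open>The upper integral is an infimum over majorants. The gap around \<open>t\<close>
    provides majorants with integrals below \<open>t\<close>, while \<open>t\<close> stays strictly
    below the bound.\<close>
  from dense[OF this] obtain t where t: "t < a * (\<integral>\<^sup>+x. h x \<partial>Q) ^ card I"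
    and "max (upper_nn_integral (PiM I (\<lambda>_. P)) f) (upper_nn_integral (PiM I (\<lambda>_. P')) f') < t"
    by blast
  then have less: "upper_nn_integral (PiM I (\<lambda>_. P)) f < t" "upper_nn_integral (PiM I (\<lambda>_. P')) f' < t"
    by simp_all
  \<comment> \<open>A majorant chosen for the product of R can be integrated over \<open>D\<close>
    without increase, since R and Q have the same measure with density \<open>h\<close>. Both
    majorants thus live on one measure.\<close>
  have majorant: "\<exists>g\<in>borel_measurable D. (\<forall>x\<in>space D. f x \<le> g x) \<and> (\<integral>\<^sup>+x. g x \<partial>D) \<le> t"
    if R: "prob_space R" "sets R = sets X" "density R h = density Q h"
      and less: "upper_nn_integral (PiM I (\<lambda>_. R)) f < t" for R f
  proof -
    obtain g where g: "g \<in> borel_measurable (PiM I (\<lambda>_. R))"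
      "\<And>x. x \<in> space (PiM I (\<lambda>_. R)) \<Longrightarrow> f x \<le> g x" "(\<integral>\<^sup>+x. g x \<partial>PiM I (\<lambda>_. R)) < t"
      using less by (rule upper_nn_integral_lessE) blast
    have sets_R: "sets D = sets (PiM I (\<lambda>_. R))"
      using R(2) unfolding sets_D by (auto cong: sets_PiM_cong)
    have h_R: "h \<in> borel_measurable R"
      unfolding measurable_cong_sets[OF R(2) refl] by (rule h)
    have le_R: "h x \<le> 1" if "x \<in> space R" for x
      using le that sets_eq_imp_space_eq[OF R(2)] by simp
    have "(\<integral>\<^sup>+x. g x \<partial>D) \<le> (\<integral>\<^sup>+x. g x \<partial>PiM I (\<lambda>_. R))"
      unfolding D_def R(3)[symmetric] using I R(1) h_R le_R g(1) by (rule nn_integral_PiM_density_le)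
    with g(3) have "(\<integral>\<^sup>+x. g x \<partial>D) \<le> t" by simp
    moreover have "g \<in> borel_measurable D"
      unfolding measurable_cong_sets[OF sets_R refl] by (rule g(1))
    ultimately show ?thesis
      using g(2) sets_eq_imp_space_eq[OF sets_R] by auto
  qed
  obtain g where [measurable]: "g \<in> borel_measurable D"
    and g: "\<And>x. x \<in> space D \<Longrightarrow> f x \<le> g x" "(\<integral>\<^sup>+x. g x \<partial>D) \<le> t"
    using majorant[OF assms(1) sets(1) common(1) less(1)] by blast
  obtain g' where [measurable]: "g' \<in> borel_measurable D"
    and g': "\<And>x. x \<in> space D \<Longrightarrow> f' x \<le> g' x" "(\<integral>\<^sup>+x. g' x \<partial>D) \<le> t"
    using majorant[OF assms(2) sets(2) common(2) less(2)] by blast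
  interpret Q: prob_space Q by fact
  have h_Q: "h \<in> borel_measurable Q"
    unfolding measurable_cong_sets[OF sets(3) refl] by (rule h)
  interpret DQ: finite_measure "density Q h"
    using Q.finite_measure_axioms h_Q le sets_eq_imp_space_eq[OF sets(3)]
    by (intro finite_measure_density_le_1) auto
  interpret DQ: product_sigma_finite "\<lambda>_. density Q h"
    by (simp add: product_sigma_finite_def DQ.sigma_finite_measure_axioms)
  \<comment> \<open>The total mass of a product is the product of the masses; the power in the bound
    arises here.\<close>
  have D_space: "emeasure D (space D) = (\<integral>\<^sup>+x. h x \<partial>Q) ^ card I"
    using DQ.emeasure_PiM[OF I, of "\<lambda>_. space Q"] by (simp add: D_def space_PiM emeasure_density_space[OF h_Q])
  have "2 * (a * (\<integral>\<^sup>+x. h x \<partial>Q) ^ card I) = (\<integral>\<^sup>+x. 2 * a \<partial>D)"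
    by (simp add: D_space mult.assoc)
  also have "\<dots> \<le> (\<integral>\<^sup>+x. g x + g' x \<partial>D)"
  proof (rule nn_integral_mono)
    fix x assume x: "x \<in> space D"
    then have "2 * a \<le> f x + f' x" using f sets_eq_imp_space_eq[OF sets_D] by simp
    also have "\<dots> \<le> g x + g' x" using x by (intro add_mono g g')
    finally show "2 * a \<le> g x + g' x" .
  qed
  also have "\<dots> = (\<integral>\<^sup>+x. g x \<partial>D) + (\<integral>\<^sup>+x. g' x \<partial>D)"
    by (rule nn_integral_add) measurable
  also have "\<dots> \<le> 2 * t"
    using add_mono[OF g(2) g'(2)] by (simp add: mult_2)
  finally have "a * (\<integral>\<^sup>+x. h x \<partial>Q) ^ card I \<le> t"
    by (simp add: ennreal_mult_le_mult_iff)
  with t show False by simp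
qed

section \<open>The seminorm at two opposite perturbations\<close>

lemma module_scale_signed: "module scale_signed"
  by unfold_locales (auto simp: fun_eq_iff algebra_simps)

text \<open>\<mu> is half the difference of the errors of \<nu> at the two points, so its seminorm
  is at most the mean of their seminorms; convexity of the power does the rest.\<close>

lemma seminorm_two_point:
  assumes E: "module.subspace scale_signed E" and N: "seminorm_on E N"
    and in_E: "\<mu>\<^sub>0 + \<mu> \<in> E" "\<mu>\<^sub>0 - \<mu> \<in> E" "\<nu> \<in> E" and p: "1 \<le> p"
  shows "2 * N \<mu> powr p \<le> N (\<nu> - (\<mu>\<^sub>0 + \<mu>)) powr p + N (\<nu> - (\<mu>\<^sub>0 - \<mu>)) powr p"
proof -
  interpret module scale_signed by (rule module_scale_signed)
  define u v where "u = \<nu> - (\<mu>\<^sub>0 - \<mu>)" and "v = \<nu> - (\<mu>\<^sub>0 + \<mu>)"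
  have uv: "u \<in> E" "v \<in> E" "scale_signed (-1) v \<in> E"
    using E in_E unfolding u_def v_def by (blast intro: subspace_diff subspace_scale)+
  \<comment> \<open>The seminorm laws hold on \<open>E\<close> only. This representation also puts
    \<mu> into \<open>E\<close>, and \<open>scale_signed (-1)\<close> replaces negation to match
    homogeneity.\<close>
  have \<mu>_eq: "\<mu> = scale_signed (1/2) (u + scale_signed (-1) v)"
    by (auto simp: u_def v_def fun_eq_iff)
  have sum: "u + scale_signed (-1) v \<in> E"
    using E uv by (blast intro: subspace_add)
  then have \<mu>: "\<mu> \<in> E" unfolding \<mu>_eq using E by (blast intro: subspace_scale)
  have scale: "N (scale_signed c w) = \<bar>c\<bar> * N w" if "w \<in> E" for c w
    using N that unfolding seminorm_on_def by blast
  have "N \<mu> = N (u + scale_signed (-1) v) / 2"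
    using scale[OF sum, of "1/2"] \<mu>_eq by simp
  also have "N (u + scale_signed (-1) v) \<le> N u + N v"
    using N uv scale[OF uv(2), of "-1"] unfolding seminorm_on_def by force
  finally have le: "N \<mu> \<le> (N u + N v) / 2" by simp
  have nonneg: "0 \<le> N \<mu>" "0 \<le> N u" "0 \<le> N v"
    using N uv \<mu> unfolding seminorm_on_def by auto
  have "N \<mu> powr p \<le> ((N u + N v) / 2) powr p"
    using le nonneg p by (intro powr_mono2) auto
  also have "\<dots> \<le> (N u powr p + N v powr p) / 2"
    using nonneg p by (intro powr_midpoint_le)
  finally show ?thesis by (simp add: u_def v_def)
qed

section \<open>The minimax lower bound for mixing distributions\<close>

theorem proposition1:
  fixes X :: "'x measure" and \<Theta> :: "'t measure"
    and K :: "'t \<Rightarrow> 'x measure"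
    and E :: "('t set \<Rightarrow> real) set" and \<E> :: "('t set \<Rightarrow> real) measure"
    and N :: "('t set \<Rightarrow> real) \<Rightarrow> real"
    and h :: "'x \<Rightarrow> real"
    and C :: "('t set \<Rightarrow> real) set" and \<mu>\<^sub>0 :: "'t set \<Rightarrow> real"
    and p :: real and n :: nat
  assumes kernel: "K \<in> \<Theta> \<rightarrow>\<^sub>M prob_algebra X"
    and E_signed: "E \<subseteq> signed_measures \<Theta>"
    and E_subspace: "module.subspace scale_signed E"
    and seminorm: "seminorm_on E N"
    and space_\<E>: "space \<E> = E"
    and N_measurable: "N \<in> borel_measurable \<E>"
    and h_measurable: "h \<in> borel_measurable X"
    and h_bounds: "\<And>x. x \<in> space X \<Longrightarrow> 0 \<le> h x \<and> h x \<le> 1"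
    and C_symmetric: "C = uminus ` C"
    and C_kernel: "C \<subseteq> {\<mu> \<in> signed_measures \<Theta>. (mult_adjoint X h \<circ> kernel_adjoint \<Theta> X K) \<mu> = 0}"
    and \<mu>\<^sub>0_prob: "\<mu>\<^sub>0 \<in> prob_measures \<Theta>"
    and p: "1 \<le> p"
  shows "(INF \<mu>' \<in> PiM {..<n} (\<lambda>_. X) \<rightarrow>\<^sub>M \<E>.
            SUP \<mu> \<in> ((+) \<mu>\<^sub>0 ` C) \<inter> (E \<inter> prob_measures \<Theta>). risk \<Theta> X K N p n \<mu>' \<mu>)
         \<ge> (SUP \<mu> \<in> {\<mu> \<in> C. \<mu>\<^sub>0 + \<mu> \<in> E \<inter> prob_measures \<Theta> \<and> \<mu>\<^sub>0 - \<mu> \<in> E \<inter> prob_measures \<Theta>}.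
              ennreal (N \<mu> powr p))
           * ennreal (signed_integral X (kernel_adjoint \<Theta> X K \<mu>\<^sub>0) h ^ n)"
proof -
  obtain R\<^sub>0 where R\<^sub>0: "R\<^sub>0 \<in> space (prob_algebra \<Theta>)" "\<mu>\<^sub>0 = measure R\<^sub>0"
    using \<mu>\<^sub>0_prob by (auto simp: prob_measures_def)
  \<comment> \<open>The mixture with mixing distribution \<open>\<mu>\<^sub>0\<close>, the reference
    for both perturbed mixtures.\<close>
  define Q where "Q = R\<^sub>0 \<bind> K"
  have Q: "Q \<in> space (prob_algebra X)"
    unfolding Q_def using kernel R\<^sub>0(1) by (rule bind_in_prob_algebra)
  note [measurable] = h_measurable
  have sp_Q: "space Q = space X" using prob_algebraD(3)[OF Q] by (rule sets_eq_imp_space_eq)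
  have int_h: "(\<integral>\<^sup>+x. h x \<partial>Q) = ennreal (\<integral>x. h x \<partial>Q)"
  proof (rule nn_integral_eq_integral)
    interpret Q: prob_space Q using Q by (rule prob_algebraD)
    show "integrable Q h"
      using h_bounds prob_algebraD(3)[OF Q]
      by (intro Q.integrable_const_bound[of _ 1]) (auto simp: sp_Q cong: measurable_cong_sets)
  qed (use h_bounds sp_Q in auto)
  have adj: "signed_integral X (kernel_adjoint \<Theta> X K \<mu>\<^sub>0) h = (\<integral>x. h x \<partial>Q)"
    using signed_integral_measure[OF prob_algebraD(2,3)[OF Q]]
    by (simp add: R\<^sub>0(2) kernel_adjoint_measure[OF kernel R\<^sub>0(1)] Q_def)
  have pow: "ennreal (signed_integral X (kernel_adjoint \<Theta> X K \<mu>\<^sub>0) h ^ n) = (\<integral>\<^sup>+x. h x \<partial>Q) ^ card {..<n}"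
  proof -
    have "0 \<le> (\<integral>x. h x \<partial>Q)"
      using h_bounds sp_Q by (intro integral_nonneg_AE) auto
    then show ?thesis by (simp add: adj int_h ennreal_power)
  qed
  \<comment> \<open>The kernel condition enters here: the mixtures at
    \<open>\<mu>\<^sub>0 + \<mu>\<close> and \<open>\<mu>\<^sub>0\<close> differ by a signed measure
    that multiplication by \<open>h\<close> annihilates.\<close>
  have mix: "\<exists>P\<in>space (prob_algebra X). kernel_adjoint \<Theta> X K (\<mu>\<^sub>0 + \<mu>) = measure P \<and>
      density P h = density Q h"
    if \<mu>: "\<mu> \<in> C" "\<mu>\<^sub>0 + \<mu> \<in> prob_measures \<Theta>" for \<mu>
  proof -
    obtain R where R: "R \<in> space (prob_algebra \<Theta>)" "\<mu>\<^sub>0 + \<mu> = measure R"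
      using \<mu>(2) by (auto simp: prob_measures_def)
    then have "\<mu> = measure R - measure R\<^sub>0" using R\<^sub>0 by (metis add_diff_cancel_left')
    moreover have "mult_adjoint X h (kernel_adjoint \<Theta> X K \<mu>) = 0"
      using \<mu>(1) C_kernel by auto
    ultimately have "mult_adjoint X h (measure (R \<bind> K) - measure Q) = 0"
      by (simp add: kernel_adjoint_diff[OF kernel R(1) R\<^sub>0(1)] Q_def)
    moreover have P: "R \<bind> K \<in> space (prob_algebra X)"
      using kernel R(1) by (rule bind_in_prob_algebra)
    ultimately have "density (R \<bind> K) h = density Q h"
      using prob_algebraD[OF P] prob_algebraD[OF Q] h_bounds
      by (intro density_eq_if_mult_adjoint_eq_0[where B = 1]) auto
    with P show ?thesis
      by (auto simp: R(2) kernel_adjoint_measure[OF kernel R(1)])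
  qed
  have "ennreal (N \<mu> powr p) * ennreal (signed_integral X (kernel_adjoint \<Theta> X K \<mu>\<^sub>0) h ^ n) \<le>
      (SUP \<mu> \<in> ((+) \<mu>\<^sub>0 ` C) \<inter> (E \<inter> prob_measures \<Theta>). risk \<Theta> X K N p n \<mu>' \<mu>)"
    if \<mu>': "\<mu>' \<in> PiM {..<n} (\<lambda>_. X) \<rightarrow>\<^sub>M \<E>" and \<mu>: "\<mu> \<in> C"
      and in_E1: "\<mu>\<^sub>0 + \<mu> \<in> E \<inter> prob_measures \<Theta>" "\<mu>\<^sub>0 - \<mu> \<in> E \<inter> prob_measures \<Theta>" for \<mu>' \<mu>
  proof -
    \<comment> \<open>Symmetry of \<open>C\<close> makes the opposite perturbation available, both
      for \<open>mix\<close> and as a competitor in the supremum of risks.\<close>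
    have \<mu>_neg: "- \<mu> \<in> C" using \<mu> C_symmetric by auto
    obtain P where P: "P \<in> space (prob_algebra X)" "kernel_adjoint \<Theta> X K (\<mu>\<^sub>0 + \<mu>) = measure P"
      "density P h = density Q h"
      using mix[OF \<mu>] in_E1 by auto
    obtain P' where P': "P' \<in> space (prob_algebra X)" "kernel_adjoint \<Theta> X K (\<mu>\<^sub>0 - \<mu>) = measure P'"
      "density P' h = density Q h"
      using mix[OF \<mu>_neg] in_E1 by auto
    have "2 * ennreal (N \<mu> powr p) \<le>
        ennreal (N (\<mu>' x - (\<mu>\<^sub>0 + \<mu>)) powr p) + ennreal (N (\<mu>' x - (\<mu>\<^sub>0 - \<mu>)) powr p)"
      if "x \<in> space (PiM {..<n} (\<lambda>_. X))" for x
    proof -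
      have "\<mu>' x \<in> E" using measurable_space[OF \<mu>' that] space_\<E> by simp
      then have "2 * N \<mu> powr p \<le> N (\<mu>' x - (\<mu>\<^sub>0 + \<mu>)) powr p + N (\<mu>' x - (\<mu>\<^sub>0 - \<mu>)) powr p"
        using in_E1 by (intro seminorm_two_point[OF E_subspace seminorm _ _ _ p]) auto
      then have "ennreal (2 * N \<mu> powr p) \<le>
          ennreal (N (\<mu>' x - (\<mu>\<^sub>0 + \<mu>)) powr p + N (\<mu>' x - (\<mu>\<^sub>0 - \<mu>)) powr p)"
        by (rule ennreal_leI)
      then show ?thesis by (simp add: ennreal_mult)
    qed
    then have "ennreal (N \<mu> powr p) * (\<integral>\<^sup>+x. h x \<partial>Q) ^ card {..<n} \<le>
        max (upper_nn_integral (PiM {..<n} (\<lambda>_. P)) (\<lambda>x. ennreal (N (\<mu>' x - (\<mu>\<^sub>0 + \<mu>)) powr p)))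
          (upper_nn_integral (PiM {..<n} (\<lambda>_. P')) (\<lambda>x. ennreal (N (\<mu>' x - (\<mu>\<^sub>0 - \<mu>)) powr p)))"
      using prob_algebraD[OF P(1)] prob_algebraD[OF P'(1)] prob_algebraD[OF Q] P(3) P'(3) h_bounds
      by (intro two_point_bound[where X = X]) auto
    also have "\<dots> = max (risk \<Theta> X K N p n \<mu>' (\<mu>\<^sub>0 + \<mu>)) (risk \<Theta> X K N p n \<mu>' (\<mu>\<^sub>0 - \<mu>))"
      using as_measure_measure[OF prob_algebraD(2,3)[OF P(1)]]
        as_measure_measure[OF prob_algebraD(2,3)[OF P'(1)]]
      by (simp add: risk_def P(2) P'(2))
    also have "\<dots> \<le> (SUP \<mu> \<in> ((+) \<mu>\<^sub>0 ` C) \<inter> (E \<inter> prob_measures \<Theta>). risk \<Theta> X K N p n \<mu>' \<mu>)"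
    proof -
      have "\<mu>\<^sub>0 - \<mu> = \<mu>\<^sub>0 + - \<mu>" by simp
      then have "\<mu>\<^sub>0 + \<mu> \<in> (+) \<mu>\<^sub>0 ` C \<inter> (E \<inter> prob_measures \<Theta>)"
        "\<mu>\<^sub>0 - \<mu> \<in> (+) \<mu>\<^sub>0 ` C \<inter> (E \<inter> prob_measures \<Theta>)"
        using \<mu> \<mu>_neg in_E1 by blast+
      then show ?thesis by (blast intro: max.boundedI SUP_upper)
    qed
    finally show ?thesis by (simp add: pow)
  qed
  \<comment> \<open>In \<open>ennreal\<close> the constant factor moves inside the supremum, so the
    bound for each estimator and each perturbation suffices.\<close>
  then show ?thesis
    by (intro INF_greatest) (auto simp: SUP_mult_right_ennreal intro!: SUP_least)
qed

end
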